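(* Let $r$ be a nonnegative integer and $n$ a positive integer. Then $$\sum_{k=0}^{n-1}(2k+1)k^r(k+1)^r A_k \equiv 0 \pmod n,$$ $$\sum_{k=0}^{n-1}(2k+1)^{2r+1}A_k \equiv 0 \pmod n,$$ where $A_k$ denotes the $k$-th Apéry number.
   Context: The Apéry numbers are defined, for each nonnegative integer $n$, by $A_n=\sum_{k=0}^{n}\binom{n+k}{2k}^2\binom{2k}{k}^2$. The convention $0^0=1$ is used (so $k^r=1$ when $r=0$). *)

theory Defs
  imports "HOL-Number_Theory.Cong"
begin

definition apery :: "nat \<Rightarrow> nat" where
  "apery n = (\<Sum>k=0..n. ((n + k) choose (2 * k))^2 * ((2 * k) choose k)^2)"

end

theory Submission
  imports Defs
begin

text \<open>
  The summand \<open>T m k = C(k+m, 2m) C(2m, m)\<close> is a polynomial of degree \<open>m\<close> in \<open>x = k (k + 1)\<close>,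
  and the integral span of the \<open>T m\<close> is a ring: \<open>T i T j\<close> is the sum of
  \<open>C(i+j, m) C(m, i) C(m, j) T m\<close> over \<open>m\<close>. As \<open>x = T 1\<close>, both the Apery numbers and their
  products with powers of \<open>x\<close> are combinations of the \<open>T m\<close>, and each sum of \<open>(2k + 1) T m k\<close>
  over \<open>k < n\<close> telescopes to a multiple of \<open>n\<close>. The second congruence reduces to the first by
  expanding \<open>(2k + 1)^2 = 4x + 1\<close>.
\<close>

definition apery_term :: "nat \<Rightarrow> nat \<Rightarrow> nat" where
  "apery_term m k = ((k + m) choose (2 * m)) * ((2 * m) choose m)"

lemma apery_term_eq_0: "k < m \<Longrightarrow> apery_term m k = 0"
  by (simp add: apery_term_def)

lemma apery_term_0: "apery_term 0 k = 1"
  by (simp add: apery_term_def)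

text \<open>The terms with \<open>k < m\<close> vanish, so the range can be made the same for all
  \<open>k < n\<close>; this lets the sums over \<open>k\<close> and \<open>m\<close> be
  interchanged later.\<close>

lemma apery_eq_sum_apery_term:
  assumes "k < n"
  shows "apery k = (\<Sum>m<n. (apery_term m k)^2)"
proof -
  have "apery k = (\<Sum>m=0..k. (apery_term m k)^2)"
    by (simp add: apery_def apery_term_def power_mult_distrib)
  also have "\<dots> = (\<Sum>m<n. (apery_term m k)^2)"
    using assms by (intro sum.mono_neutral_left) (auto simp: apery_term_eq_0)
  finally show ?thesis .
qed

text \<open>For \<open>m \<le> k\<close> both sides equal \<open>(k + m)! / (m!^2 (k - m)!)\<close>.
  In the product form each factor has a simple recurrence in \<open>m\<close>.\<close>

lemma apery_term_eq_choose: "apery_term m k = (k choose m) * ((k + m) choose m)"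
proof (cases "m \<le> k")
  case True
  then have "((k + m) choose (2 * m)) * ((2 * m) choose m)
      = ((k + m) choose m) * ((k + m - m) choose (2 * m - m))"
    by (intro choose_mult) auto
  then show ?thesis by (simp add: apery_term_def mult_2)
qed (simp add: apery_term_def binomial_eq_0)

text \<open>Over the integers the difference does not truncate; for \<open>k > n\<close> both
  binomials vanish.\<close>

lemma int_Suc_mult_choose_Suc:
  "(int k + 1) * int (n choose Suc k) = (int n - int k) * int (n choose k)"
proof (cases "k \<le> n")
  case True
  have "Suc k * (n choose Suc k) = (n - k) * (n choose k)"
    using binomial_absorb_comp[of n k] binomial_absorption[of k n] by simp
  then have "int (Suc k * (n choose Suc k)) = int ((n - k) * (n choose k))"
    by presburger
  then show ?thesis using True by (simp add: of_nat_diff distrib_right add.commute)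
qed (simp add: binomial_eq_0)

lemma int_Suc_mult_choose:
  "(int n + 1) * int (n choose k) = (int n + 1 - int k) * int (Suc n choose k)"
proof (cases "k \<le> Suc n")
  case True
  have "(Suc n - k) * (Suc n choose k) = Suc n * (n choose k)"
    using binomial_absorb_comp[of "Suc n" k] by simp
  then have "int ((Suc n - k) * (Suc n choose k)) = int (Suc n * (n choose k))"
    by presburger
  then show ?thesis using True by (simp add: of_nat_diff distrib_right add.commute)
qed (simp add: binomial_eq_0)

text \<open>The two factors contribute \<open>k - m\<close> and \<open>k + m + 1\<close>, whose
  product is \<open>x - m (m + 1)\<close>. This is what makes \<open>T m\<close> a polynomial of
  degree \<open>m\<close> in \<open>x\<close>.\<close>

lemma apery_term_Suc:
  "(int m + 1)^2 * int (apery_term (Suc m) k)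
    = (int k * (int k + 1) - int m * (int m + 1)) * int (apery_term m k)"
proof -
  have a: "(int m + 1) * int (k choose Suc m) = (int k - int m) * int (k choose m)"
    by (rule int_Suc_mult_choose_Suc)
  have "Suc m * ((k + Suc m) choose Suc m) = (k + Suc m) * ((k + m) choose m)"
    using binomial_absorption[of m "k + Suc m"] by simp
  then have "int (Suc m * ((k + Suc m) choose Suc m)) = int ((k + Suc m) * ((k + m) choose m))"
    by presburger
  then have b: "(int m + 1) * int ((k + Suc m) choose Suc m) = (int k + int m + 1) * int ((k + m) choose m)"
    by (simp add: algebra_simps del: binomial_Suc_Suc)
  have "(int m + 1)^2 * int (apery_term (Suc m) k)
    = ((int m + 1) * int (k choose Suc m)) * ((int m + 1) * int ((k + Suc m) choose Suc m))"
    by (simp add: apery_term_eq_choose power2_eq_square del: binomial_Suc_Suc add_Suc_right)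
  also have "\<dots> = (int k * (int k + 1) - int m * (int m + 1)) * int (apery_term m k)"
    unfolding a b apery_term_eq_choose by (simp add: algebra_simps)
  finally show ?thesis .
qed

lemma mult_apery_term:
  "k * (k + 1) * apery_term m k
    = (m + 1)^2 * apery_term (Suc m) k + m * (m + 1) * apery_term m k"
proof -
  have "int (k * (k + 1) * apery_term m k)
      = int ((m + 1)^2 * apery_term (Suc m) k + m * (m + 1) * apery_term m k)"
    using apery_term_Suc[of m k] by (simp add: algebra_simps)
  then show ?thesis by presburger
qed

text \<open>Induction on \<open>n\<close>: the increment of the right-hand side is the next summand.
  Its explicit factor \<open>n\<close> is the source of all the divisibility below.\<close>

lemma sum_odd_apery_term:
  "(\<Sum>k<n. (2 * k + 1) * apery_term m k) = n * (n choose Suc m) * ((n + m) choose m)"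
proof (induction n)
  case (Suc n)
  let ?a = "int (n choose m)" and ?b = "int ((n + m) choose m)"
  have "Suc m * (Suc n choose Suc m) = Suc n * (n choose m)"
    using binomial_absorption[of m "Suc n"] by simp
  then have "int (Suc m * (Suc n choose Suc m)) = int (Suc n * (n choose m))"
    by presburger
  then have 1: "(int m + 1) * int (Suc n choose Suc m) = (int n + 1) * ?a"
    by (simp add: algebra_simps del: binomial_Suc_Suc)
  have 2: "(int n + 1) * int ((Suc n + m) choose m) = (int n + int m + 1) * ?b"
    using int_Suc_mult_choose[of "n + m" m] by (simp add: algebra_simps)
  have 3: "(int m + 1) * int (n choose Suc m) = (int n - int m) * ?a"
    by (rule int_Suc_mult_choose_Suc)
  have "(int m + 1) * int (Suc n * (Suc n choose Suc m) * ((Suc n + m) choose m))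
      = ((int m + 1) * int (Suc n choose Suc m)) * ((int n + 1) * int ((Suc n + m) choose m))"
    by (simp add: algebra_simps del: binomial_Suc_Suc)
  also have "\<dots> = (int n + 1) * ?a * ((int n + int m + 1) * ?b)"
    unfolding 1 2 ..
  \<comment> \<open>The coefficients of \<open>?a * ?b\<close> agree:
    \<open>(n + 1)(n + m + 1) = n (n - m) + (m + 1)(2n + 1)\<close>.\<close>
  also have "\<dots> = int n * ((int n - int m) * ?a) * ?b + (int m + 1) * (2 * int n + 1) * (?a * ?b)"
    by (simp add: algebra_simps)
  also have "\<dots> = (int m + 1) * int (n * (n choose Suc m) * ((n + m) choose m)
      + (2 * n + 1) * apery_term m n)"
    unfolding 3[symmetric] apery_term_eq_choose by (simp add: algebra_simps)
  finally have "int (Suc n * (Suc n choose Suc m) * ((Suc n + m) choose m))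
      = int (n * (n choose Suc m) * ((n + m) choose m) + (2 * n + 1) * apery_term m n)"
    by simp
  then have "Suc n * (Suc n choose Suc m) * ((Suc n + m) choose m)
      = n * (n choose Suc m) * ((n + m) choose m) + (2 * n + 1) * apery_term m n"
    by presburger
  with Suc.IH show ?case by (simp del: binomial_Suc_Suc)
qed simp

text \<open>One factor \<open>x\<close> turns \<open>T m\<close> into a combination of
  \<open>T (m + 1)\<close> and \<open>T m\<close>, so the induction on \<open>r\<close> needs its
  hypothesis at both indices.\<close>

lemma dvd_sum_odd_power_apery_term:
  "n dvd (\<Sum>k<n. (2 * k + 1) * (k * (k + 1))^r * apery_term m k)"
proof (induction r arbitrary: m)
  case 0
  show ?case using sum_odd_apery_term[of m n] by (simp add: mult.assoc)
next
  case (Suc r)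
  have "(\<Sum>k<n. (2 * k + 1) * (k * (k + 1))^Suc r * apery_term m k)
      = (\<Sum>k<n. (2 * k + 1) * (k * (k + 1))^r * (k * (k + 1) * apery_term m k))"
    by (simp only: power_Suc mult_ac)
  also have "\<dots> = (m + 1)^2 * (\<Sum>k<n. (2 * k + 1) * (k * (k + 1))^r * apery_term (Suc m) k)
      + m * (m + 1) * (\<Sum>k<n. (2 * k + 1) * (k * (k + 1))^r * apery_term m k)"
    unfolding mult_apery_term
    by (simp add: sum.distrib sum_distrib_left algebra_simps)
  finally show ?case using Suc.IH by (simp add: dvd_add dvd_mult)
qed

text \<open>The structure constants of the ring spanned by the \<open>T m\<close>; nonzero exactly
  when \<open>max i j \<le> m \<le> i + j\<close>.\<close>

definition linearization_coeff :: "nat \<Rightarrow> nat \<Rightarrow> nat \<Rightarrow> nat" where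
  "linearization_coeff i j m = ((i + j) choose m) * (m choose i) * (m choose j)"

text \<open>This is the comparison of coefficients of \<open>T (m + 1)\<close> when
  \<open>T i T j\<close> is multiplied by \<open>x - i (i + 1)\<close>.\<close>

lemma linearization_coeff_Suc_Suc:
  "(int i + 1)^2 * int (linearization_coeff (Suc i) j (Suc m))
    = (int m + 1)^2 * int (linearization_coeff i j m)
    + ((int m + 1) * (int m + 2) - int i * (int i + 1)) * int (linearization_coeff i j (Suc m))"
proof -
  let ?A = "int ((i + j) choose m)" and ?B = "int ((i + j) choose Suc m)"
  let ?p = "int (Suc m choose i)" and ?q = "int (Suc m choose j)"
  have 1: "(int i + 1) * int (Suc m choose Suc i) = (int m + 1 - int i) * ?p"
    using int_Suc_mult_choose_Suc[of i "Suc m"] by (simp add: algebra_simps del: binomial_Suc_Suc)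
  have 2: "(int m + 1) * int (m choose i) = (int m + 1 - int i) * ?p"
    by (rule int_Suc_mult_choose)
  have 3: "(int m + 1) * int (m choose j) = (int m + 1 - int j) * ?q"
    by (rule int_Suc_mult_choose)
  have 4: "(int m + 1) * ?B = (int i + int j - int m) * ?A"
    using int_Suc_mult_choose_Suc[of m "i + j"] by simp
  have "(int i + 1)^2 * int (linearization_coeff (Suc i) j (Suc m))
      = (int i + 1) * (?A + ?B) * ((int i + 1) * int (Suc m choose Suc i)) * ?q"
    by (simp add: linearization_coeff_def power2_eq_square algebra_simps)
  also have "\<dots> = (int m + 1 - int i) * ?p * ?q * ((int i + 1) * (?A + ?B))"
    unfolding 1 by (simp add: algebra_simps)
  \<comment> \<open>\<open>?A + ?B\<close> comes from Pascal's rule. Fact \<open>4\<close> shifts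
    weight between the two so that \<open>m + 1 - j\<close> combines with \<open>?q\<close> into
    \<open>m choose j\<close>, and
    \<open>(m + 1 - i)(m + i + 2) = (m + 1)(m + 2) - i (i + 1)\<close>.\<close>
  also have "(int i + 1) * (?A + ?B) = (int m + 1 - int j) * ?A + (int m + int i + 2) * ?B"
    using 4 by (simp add: algebra_simps)
  also have "(int m + 1 - int i) * ?p * ?q * \<dots>
      = ?A * ((int m + 1 - int i) * ?p) * ((int m + 1 - int j) * ?q)
      + ((int m + 1) * (int m + 2) - int i * (int i + 1)) * (?B * ?p * ?q)"
    by (simp add: algebra_simps del: binomial_Suc_Suc)
  also have "\<dots> = (int m + 1)^2 * int (linearization_coeff i j m)
      + ((int m + 1) * (int m + 2) - int i * (int i + 1)) * int (linearization_coeff i j (Suc m))"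
    unfolding 2[symmetric] 3[symmetric]
    by (simp add: linearization_coeff_def power2_eq_square mult_ac del: binomial_Suc_Suc)
  finally show ?thesis .
qed

lemma apery_term_mult_apery_term:
  "int (apery_term i k) * int (apery_term j k)
    = (\<Sum>m\<le>i + j. int (linearization_coeff i j m) * int (apery_term m k))"
proof (induction i)
  case 0
  \<comment> \<open>As \<open>T 0 = 1\<close>, only \<open>m = j\<close> may survive:
    \<open>m choose j\<close> vanishes below \<open>j\<close>.\<close>
  have "(\<Sum>m\<le>j. int (linearization_coeff 0 j m) * int (apery_term m k))
      = (\<Sum>m\<in>{j}. int (linearization_coeff 0 j m) * int (apery_term m k))"
    by (rule sum.mono_neutral_right) (auto simp: linearization_coeff_def)
  then show ?case by (simp add: apery_term_0 linearization_coeff_def)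
next
  case (Suc i)
  let ?c = "\<lambda>i m. int (linearization_coeff i j m)" and ?T = "\<lambda>m. int (apery_term m k)"
  let ?d = "\<lambda>m. int m * (int m + 1) - int i * (int i + 1)"
  \<comment> \<open>Write \<open>x - i (i + 1)\<close> as \<open>(x - m (m + 1)) + ?d m\<close>; the
    first part raises the index.\<close>
  have step: "(int k * (int k + 1) - int i * (int i + 1)) * ?T m
      = (int m + 1)^2 * ?T (Suc m) + ?d m * ?T m" for m
    using apery_term_Suc[of m k] by (simp add: algebra_simps)
  have top: "?c i (Suc (i + j)) = 0"
    by (simp add: linearization_coeff_def)
  \<comment> \<open>\<open>?d 0\<close> vanishes for \<open>i = 0\<close>, and
    \<open>0 choose i\<close> vanishes otherwise.\<close>
  have bottom: "?d 0 * ?c i 0 = 0" "?c (Suc i) 0 = 0"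
    by (auto simp: linearization_coeff_def)
  have "(int i + 1)^2 * (?T (Suc i) * ?T j)
      = (int k * (int k + 1) - int i * (int i + 1)) * (?T i * ?T j)"
    using apery_term_Suc[of i k] by (simp add: mult.assoc[symmetric])
  also have "\<dots> = (\<Sum>m\<le>i + j. ?c i m * ((int k * (int k + 1) - int i * (int i + 1)) * ?T m))"
    unfolding Suc.IH sum_distrib_left by (simp only: mult_ac)
  also have "\<dots> = (\<Sum>m\<le>i + j. (int m + 1)^2 * ?c i m * ?T (Suc m)) + (\<Sum>m\<le>i + j. ?d m * ?c i m * ?T m)"
    unfolding step by (simp only: distrib_left sum.distrib mult_ac)
  \<comment> \<open>Adding a zero term at the top and dropping one at the bottom aligns this sum
    with the other one, in \<open>?T (Suc m)\<close>.\<close>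
  also have "(\<Sum>m\<le>i + j. ?d m * ?c i m * ?T m) = (\<Sum>m\<le>Suc (i + j). ?d m * ?c i m * ?T m)"
    using top by simp
  also have "\<dots> = (\<Sum>m\<le>i + j. ?d (Suc m) * ?c i (Suc m) * ?T (Suc m))"
    using bottom(1) by (subst sum.atMost_Suc_shift) simp
  also have "(\<Sum>m\<le>i + j. (int m + 1)^2 * ?c i m * ?T (Suc m)) + \<dots>
      = (\<Sum>m\<le>i + j. (int i + 1)^2 * ?c (Suc i) (Suc m) * ?T (Suc m))"
    unfolding linearization_coeff_Suc_Suc sum.distrib[symmetric]
    by (simp add: algebra_simps)
  also have "\<dots> = (int i + 1)^2 * (\<Sum>m\<le>Suc i + j. ?c (Suc i) m * ?T m)"
    using bottom(2) by (simp add: sum.atMost_Suc_shift sum_distrib_left mult.assoc del: sum.atMost_Suc)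
  finally show ?case by simp
qed

lemma apery_term_squared:
  "(apery_term j k)^2 = (\<Sum>m\<le>2 * j. linearization_coeff j j m * apery_term m k)"
proof -
  have "int ((apery_term j k)^2) = int (\<Sum>m\<le>2 * j. linearization_coeff j j m * apery_term m k)"
    using apery_term_mult_apery_term[of j k j] by (simp add: power2_eq_square mult_2)
  then show ?thesis by presburger
qed

text \<open>The coefficients of \<open>apery k\<close> in the \<open>T m\<close> do not depend on
  \<open>k\<close>, so with the sum over \<open>k\<close> moved innermost each inner sum is already
  known to be divisible by \<open>n\<close>.\<close>

lemma dvd_sum_odd_power_apery:
  "n dvd (\<Sum>k<n. (2 * k + 1) * (k * (k + 1))^r * apery k)"
proof -
  let ?w = "\<lambda>k::nat. (2 * k + 1) * (k * (k + 1))^r"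
  have "(\<Sum>k<n. ?w k * apery k)
      = (\<Sum>k<n. \<Sum>j<n. \<Sum>m\<le>2 * j. linearization_coeff j j m * (?w k * apery_term m k))"
  proof (rule sum.cong)
    fix k assume "k \<in> {..<n}"
    then have "apery k = (\<Sum>j<n. \<Sum>m\<le>2 * j. linearization_coeff j j m * apery_term m k)"
      by (simp add: apery_eq_sum_apery_term apery_term_squared)
    then show "?w k * apery k
        = (\<Sum>j<n. \<Sum>m\<le>2 * j. linearization_coeff j j m * (?w k * apery_term m k))"
      by (simp only: sum_distrib_left mult_ac)
  qed simp
  also have "\<dots> = (\<Sum>j<n. \<Sum>m\<le>2 * j. \<Sum>k<n. linearization_coeff j j m * (?w k * apery_term m k))"
    by (subst sum.swap, rule sum.cong, rule refl, rule sum.swap)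
  also have "\<dots> = (\<Sum>j<n. \<Sum>m\<le>2 * j. linearization_coeff j j m * (\<Sum>k<n. ?w k * apery_term m k))"
    by (simp only: sum_distrib_left)
  also have "n dvd \<dots>"
    by (intro dvd_sum dvd_mult dvd_sum_odd_power_apery_term)
  finally show ?thesis .
qed

lemma dvd_sum_odd_odd_power_apery:
  "n dvd (\<Sum>k<n. (2 * k + 1)^(2 * r + 1) * apery k)"
proof -
  have "(2 * k + 1)^(2 * r + 1) * apery k
      = (\<Sum>s\<le>r. (r choose s) * 4^s * ((2 * k + 1) * (k * (k + 1))^s * apery k))" for k
  proof -
    have "(2 * k + 1)^2 = 4 * (k * (k + 1)) + 1"
      by (simp add: power2_eq_square)
    then have "(2 * k + 1)^(2 * r + 1) = (2 * k + 1) * (4 * (k * (k + 1)) + 1)^r"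
      \<comment> \<open>One odd factor is kept as the weight \<open>2k + 1\<close>; the remaining
        even power is a power of \<open>4x + 1\<close>.\<close>
      by (simp only: power_add power_mult power_one_right mult.commute[of _ "2 * k + 1"])
    also have "(4 * (k * (k + 1)) + 1)^r = (\<Sum>s\<le>r. (r choose s) * 4^s * (k * (k + 1))^s)"
      unfolding binomial by (simp only: power_mult_distrib power_one mult_1_right of_nat_id mult.assoc)
    finally show ?thesis
      by (simp only: sum_distrib_left sum_distrib_right mult_ac)
  qed
  then have "(\<Sum>k<n. (2 * k + 1)^(2 * r + 1) * apery k)
      = (\<Sum>s\<le>r. (r choose s) * 4^s * (\<Sum>k<n. (2 * k + 1) * (k * (k + 1))^s * apery k))"
    by (simp only: sum_distrib_left) (rule sum.swap)
  also have "n dvd \<dots>"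
    by (intro dvd_sum dvd_mult dvd_sum_odd_power_apery)
  finally show ?thesis .
qed

theorem theorem1p1:
  fixes r n :: nat
  assumes "n > 0"
  shows "[(\<Sum>k=0..<n. (2 * k + 1) * k^r * (k + 1)^r * apery k) = 0] (mod n) \<and>
         [(\<Sum>k=0..<n. (2 * k + 1)^(2 * r + 1) * apery k) = 0] (mod n)"
  using dvd_sum_odd_power_apery[of n r] dvd_sum_odd_odd_power_apery[of n r]
  unfolding cong_0_iff atLeast0LessThan power_mult_distrib mult.assoc by blast

end
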